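(* Let $k\ge0$ and $n\in[2^k,2^{k+1})$. Then $$M(n)\begin{bmatrix}1\\1\end{bmatrix}=\begin{bmatrix}q^{-k}h_q(n-1)\\ q^{-k-1}h_q(n)\end{bmatrix}.$$
   Context: $h_q(n)=\sum_\eta q^{\ell(\eta)}$ over hyperbinary partitions $\eta$ of $n$ (partitions into powers of $2$, each part used at most twice), $\ell(\eta)$ = number of parts; $h_q(0)=1$. Let $L=\begin{bmatrix}1&0\\1&q^{-1}\end{bmatrix}$, $R=\begin{bmatrix}q&1\\0&1\end{bmatrix}$. For $n\ge1$ with binary expansion $\beta(n)=b_1b_2\cdots b_{k+1}$ ($b_1=1$ most significant), $M(n)$ is the product obtained from the word $b_{k+1}b_k\cdots b_2$ by replacing each $0$ by $L$ and each $1$ by $R$ (empty product = identity). *)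

theory Defs
  imports "HOL-Analysis.Analysis" "HOL-Library.Multiset"
begin

text \<open>
  Partitions are multisets of parts. Throughout, \<open>q\<close> is a nonzero element of an arbitrary field;
  taking \<open>q\<close> to be the generator of a field of rational functions gives the reading in which \<open>q\<close> is
  an indeterminate.
\<close>

definition hyperbinary_partitions :: "nat \<Rightarrow> nat multiset set" where
  "hyperbinary_partitions n =
    {\<eta>. (\<forall>p \<in># \<eta>. \<exists>i. p = 2 ^ i) \<and> (\<forall>p. count \<eta> p \<le> 2) \<and> sum_mset \<eta> = n}"

lemma finite_hyperbinary_partitions: "finite (hyperbinary_partitions n)"
proof (rule finite_subset)
  show "hyperbinary_partitions n \<subseteq> mset ` {xs. set xs \<subseteq> {..n} \<and> length xs \<le> n}"
  proof
    fix \<eta> assume "\<eta> \<in> hyperbinary_partitions n"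
    then have pos: "\<forall>p \<in># \<eta>. 1 \<le> p" and sum: "sum_mset \<eta> = n"
      by (auto simp: hyperbinary_partitions_def)
    have "size \<eta> \<le> sum_mset \<eta>"
      using pos by (induction \<eta>) auto
    moreover have "\<forall>p \<in># \<eta>. p \<le> sum_mset \<eta>"
      by (auto dest!: multi_member_split)
    moreover obtain xs where "mset xs = \<eta>" using ex_mset by blast
    ultimately show "\<eta> \<in> mset ` {xs. set xs \<subseteq> {..n} \<and> length xs \<le> n}"
      using sum by (intro image_eqI[of _ _ xs]) auto
  qed
  show "finite (mset ` {xs. set xs \<subseteq> {..n} \<and> length xs \<le> n})"
    by (intro finite_imageI finite_lists_length_le) simp
qed

definition hq :: "'a::field \<Rightarrow> nat \<Rightarrow> 'a" where
  "hq q n = (\<Sum>\<eta> \<in> hyperbinary_partitions n. q ^ size \<eta>)"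

definition Lmat :: "'a::field \<Rightarrow> 'a ^ 2 ^ 2" where
  "Lmat q = vector [vector [1, 0], vector [1, inverse q]]"

definition Rmat :: "'a::field \<Rightarrow> 'a ^ 2 ^ 2" where
  "Rmat q = vector [vector [q, 1], vector [0, 1]]"

text \<open>The binary expansion \<open>[b\<^sub>1, \<dots>, b\<^sub>k\<^sub>+\<^sub>1]\<close>, most significant digit first.\<close>

fun binary_expansion :: "nat \<Rightarrow> nat list" where
  "binary_expansion n = (if n = 0 then [] else binary_expansion (n div 2) @ [n mod 2])"

declare binary_expansion.simps [simp del]

text \<open>
  The word \<open>b\<^sub>k\<^sub>+\<^sub>1 \<dots> b\<^sub>2\<close> drops the leading digit and reads the rest from the least
  significant end; its first letter is the leftmost factor of the product.
\<close>

definition Mmat :: "'a::field \<Rightarrow> nat \<Rightarrow> 'a ^ 2 ^ 2" where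
  "Mmat q n =
    foldr (\<lambda>b A. (if b = 0 then Lmat q else Rmat q) ** A) (rev (tl (binary_expansion n))) (mat 1)"

end

theory Submission
  imports Defs
begin

text \<open>
  Removing the parts equal to \<open>1\<close> from a hyperbinary partition and halving the others gives
  \<open>h(2m+1) = q h(m)\<close> and \<open>h(2m+2) = h(m+1) + q\<^sup>2 h(m)\<close>. These two recurrences are exactly what left
  multiplication by \<open>R\<close> and \<open>L\<close> does to the claimed vector, and the first letter of the word of
  \<open>n\<close> is its last binary digit, so the claim follows by induction on \<open>k\<close>.
\<close>

text \<open>Inverse of the splitting step: \<open>c\<close> is the multiplicity of the part 1, and
  \<open>\<zeta>\<close> collects the halves of the even parts. Leaving \<open>c\<close>
  unrestricted turns the bound 2 into a condition to be derived.\<close>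

definition join_parts :: "nat \<Rightarrow> nat multiset \<Rightarrow> nat multiset" where
  "join_parts c \<zeta> = replicate_mset c 1 + image_mset ((*) 2) \<zeta>"

lemma size_join_parts [simp]: "size (join_parts c \<zeta>) = c + size \<zeta>"
  by (simp add: join_parts_def)

lemma sum_mset_join_parts [simp]: "sum_mset (join_parts c \<zeta>) = c + 2 * sum_mset \<zeta>"
  by (induction \<zeta>) (simp_all add: join_parts_def)

lemma count_join_parts_double [simp]: "count (join_parts c \<zeta>) (2 * p) = count \<zeta> p"
  by (induction \<zeta>) (simp_all add: join_parts_def)

lemma count_join_parts_odd: "odd p \<Longrightarrow> count (join_parts c \<zeta>) p = (if p = 1 then c else 0)"
  by (auto simp: join_parts_def count_eq_zero_iff)

text \<open>The multiplicity of 1 recovers \<open>c\<close>, and the multiplicities of even numbers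
  recover \<open>\<zeta>\<close>.\<close>

lemma join_parts_inj: "join_parts c \<zeta> = join_parts c' \<zeta>' \<longleftrightarrow> c = c' \<and> \<zeta> = \<zeta>'"
proof
  assume eq: "join_parts c \<zeta> = join_parts c' \<zeta>'"
  have "c = c'"
    using arg_cong[OF eq, of "\<lambda>\<eta>. count \<eta> 1"] by (simp add: count_join_parts_odd)
  moreover have "\<zeta> = \<zeta>'"
    by (intro multiset_eqI) (metis eq count_join_parts_double)
  ultimately show "c = c' \<and> \<zeta> = \<zeta>'" ..
qed simp

text \<open>Doubling preserves and reflects powers of two, and the only possible odd part is 1.
  Since its sum condition is trivial, membership in
  \<open>hyperbinary_partitions (sum_mset \<zeta>)\<close> just says that \<open>\<zeta>\<close> has
  admissible parts and multiplicities.\<close>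

lemma join_parts_in_hyperbinary_iff:
  "join_parts c \<zeta> \<in> hyperbinary_partitions n \<longleftrightarrow>
    c \<le> 2 \<and> \<zeta> \<in> hyperbinary_partitions (sum_mset \<zeta>) \<and> n = c + 2 * sum_mset \<zeta>"
proof -
  have power: "(\<exists>i. 2 * p = 2 ^ i) \<longleftrightarrow> (\<exists>i. p = 2 ^ i)" for p :: nat
  proof
    assume "\<exists>i. 2 * p = 2 ^ i"
    then obtain i where i: "2 * p = 2 ^ i" ..
    then show "\<exists>i. p = 2 ^ i"
      by (cases i) auto
  next
    assume "\<exists>i. p = 2 ^ i"
    then show "\<exists>i. 2 * p = 2 ^ i"
      by (metis power_Suc)
  qed
  moreover have "\<exists>i. (1::nat) = 2 ^ i"
    by (rule exI[of _ 0]) simp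
  ultimately have parts: "(\<forall>p\<in>#join_parts c \<zeta>. \<exists>i. p = 2 ^ i) \<longleftrightarrow> (\<forall>p\<in>#\<zeta>. \<exists>i. p = 2 ^ i)"
    by (auto simp: join_parts_def)
  have "(\<forall>p. count (join_parts c \<zeta>) p \<le> 2) \<longleftrightarrow> c \<le> 2 \<and> (\<forall>p. count \<zeta> p \<le> 2)"
  proof
    assume le: "\<forall>p. count (join_parts c \<zeta>) p \<le> 2"
    then show "c \<le> 2 \<and> (\<forall>p. count \<zeta> p \<le> 2)"
      using spec[OF le, of 1]
      by (metis count_join_parts_double count_join_parts_odd odd_one)
  next
    assume le: "c \<le> 2 \<and> (\<forall>p. count \<zeta> p \<le> 2)"
    then show "\<forall>p. count (join_parts c \<zeta>) p \<le> 2"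
      by (metis count_join_parts_double count_join_parts_odd evenE le0)
  qed
  then show ?thesis
    using parts by (auto simp: hyperbinary_partitions_def)
qed

text \<open>Every power of two other than 1 is even, so halving the parts different from 1 loses no
  information.\<close>

lemma hyperbinary_joinE:
  assumes "\<eta> \<in> hyperbinary_partitions n"
  obtains c \<zeta> where "\<eta> = join_parts c \<zeta>"
proof -
  have power: "\<exists>i. p = 2 ^ i" if "p \<in># \<eta>" for p
    using assms that by (auto simp: hyperbinary_partitions_def)
  let ?\<xi> = "filter_mset (\<lambda>p. p \<noteq> 1) \<eta>"
  have "image_mset (\<lambda>p. 2 * (p div 2)) ?\<xi> = image_mset (\<lambda>p. p) ?\<xi>"
  proof (intro image_mset_cong)
    fix p assume "p \<in># ?\<xi>"
    then have "p \<noteq> 1" and "\<exists>i. p = 2 ^ i"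
      using power[of p] by simp_all
    then obtain i where "p = 2 ^ i" "i \<noteq> 0"
      by (metis power_0)
    then show "2 * (p div 2) = p"
      by (cases i) auto
  qed
  then have "image_mset ((*) 2) (image_mset (\<lambda>p. p div 2) ?\<xi>) = ?\<xi>"
    by (simp add: multiset.map_comp o_def)
  moreover have "\<eta> = replicate_mset (count \<eta> 1) 1 + ?\<xi>"
    by (rule multiset_eqI) simp
  ultimately have "\<eta> = join_parts (count \<eta> 1) (image_mset (\<lambda>p. p div 2) ?\<xi>)"
    unfolding join_parts_def by simp
  then show thesis ..
qed

text \<open>The multiplicity of 1 has the parity of the total and is at most 2, hence equals
  1.\<close>

lemma hyperbinary_partitions_odd:
  "hyperbinary_partitions (2 * m + 1) = join_parts 1 ` hyperbinary_partitions m" (is "?A = ?B")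
proof (intro equalityI subsetI)
  fix \<eta> assume "\<eta> \<in> ?A"
  moreover from this obtain c \<zeta> where eta: "\<eta> = join_parts c \<zeta>"
    by (rule hyperbinary_joinE)
  ultimately have h: "c \<le> 2" "\<zeta> \<in> hyperbinary_partitions (sum_mset \<zeta>)"
      "2 * m + 1 = c + 2 * sum_mset \<zeta>"
    by (simp_all only: join_parts_in_hyperbinary_iff)
  then have "c = 1" "sum_mset \<zeta> = m"
    by presburger+
  then show "\<eta> \<in> ?B"
    using h(2) by (simp only: eta imageI)
next
  fix \<eta> assume "\<eta> \<in> ?B"
  then show "\<eta> \<in> ?A"
    by (auto simp: join_parts_in_hyperbinary_iff) (auto simp: hyperbinary_partitions_def)
qed

text \<open>Here parity leaves the multiplicities 0 and 2 for the part 1.\<close>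

lemma hyperbinary_partitions_even:
  "hyperbinary_partitions (2 * m + 2) =
    join_parts 0 ` hyperbinary_partitions (m + 1) \<union> join_parts 2 ` hyperbinary_partitions m"
  (is "?A = ?B")
proof (intro equalityI subsetI)
  fix \<eta> assume "\<eta> \<in> ?A"
  moreover from this obtain c \<zeta> where eta: "\<eta> = join_parts c \<zeta>"
    by (rule hyperbinary_joinE)
  ultimately have h: "c \<le> 2" "\<zeta> \<in> hyperbinary_partitions (sum_mset \<zeta>)"
      "2 * m + 2 = c + 2 * sum_mset \<zeta>"
    by (simp_all only: join_parts_in_hyperbinary_iff)
  then have "c = 0 \<and> sum_mset \<zeta> = m + 1 \<or> c = 2 \<and> sum_mset \<zeta> = m"
    by presburger
  then show "\<eta> \<in> ?B"
    using h eta by auto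
next
  fix \<eta> assume "\<eta> \<in> ?B"
  then show "\<eta> \<in> ?A"
    by (auto simp: join_parts_in_hyperbinary_iff) (auto simp: hyperbinary_partitions_def)
qed

lemma hyperbinary_partitions_0: "hyperbinary_partitions 0 = {{#}}"
proof -
  have "\<eta> = {#}" if "\<eta> \<in> hyperbinary_partitions 0" for \<eta>
  proof (rule ccontr)
    assume "\<eta> \<noteq> {#}"
    then obtain p where "p \<in># \<eta>"
      by blast
    then show False
      using that by (fastforce simp: hyperbinary_partitions_def)
  qed
  then show ?thesis
    by (auto simp: hyperbinary_partitions_def)
qed

lemma sum_join_parts:
  "(\<Sum>\<eta> \<in> join_parts c ` A. (q::'a::field) ^ size \<eta>) = q ^ c * (\<Sum>\<zeta> \<in> A. q ^ size \<zeta>)"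
proof -
  have "inj_on (join_parts c) A"
    by (simp add: inj_on_def join_parts_inj)
  then show ?thesis
    by (simp add: sum.reindex power_add sum_distrib_left)
qed

lemma hq_0: "hq q 0 = 1"
  by (simp add: hq_def hyperbinary_partitions_0)

lemma hq_odd: "hq q (2 * m + 1) = q * hq q m"
  unfolding hq_def hyperbinary_partitions_odd sum_join_parts by simp

lemma hq_even: "hq q (2 * m + 2) = hq q (m + 1) + q\<^sup>2 * hq q m"
proof -
  \<comment> \<open>The two families differ in the multiplicity of 1, so the sum splits.\<close>
  have "join_parts 0 ` hyperbinary_partitions (m + 1) \<inter>
      join_parts 2 ` hyperbinary_partitions m = {}"
    by (auto simp: join_parts_inj)
  then show ?thesis
    unfolding hq_def hyperbinary_partitions_even
    by (subst sum.union_disjoint)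
      (simp_all only: sum_join_parts finite_imageI finite_hyperbinary_partitions, simp)
qed

lemma binary_expansion_eq_Nil_iff: "binary_expansion n = [] \<longleftrightarrow> n = 0"
  by (subst binary_expansion.simps) simp

lemma Mmat_1: "Mmat q 1 = mat 1"
  by (simp add: Mmat_def binary_expansion.simps)

text \<open>The word is read from the least significant end, so the last digit of \<open>n\<close>
  gives the leftmost factor.\<close>

lemma Mmat_rec:
  assumes "n \<ge> 2"
  shows "Mmat q n = (if even n then Lmat q else Rmat q) ** Mmat q (n div 2)"
proof -
  have "binary_expansion n = binary_expansion (n div 2) @ [n mod 2]"
    using assms by (subst binary_expansion.simps) simp
  \<comment> \<open>Hence \<open>tl\<close> removes the leading digit of \<open>n div 2\<close> and
    not the appended last digit.\<close>
  moreover have "binary_expansion (n div 2) \<noteq> []"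
    using assms by (simp add: binary_expansion_eq_Nil_iff)
  ultimately show ?thesis
    by (simp add: Mmat_def even_iff_mod_2_eq_zero)
qed

lemma vector_2_eqI:
  "x $ 1 = y $ 1 \<Longrightarrow> x $ 2 = y $ 2 \<Longrightarrow> x = (y :: 'a ^ 2)"
  by (simp add: vec_eq_iff forall_2)

lemma Lmat_mult_vector: "Lmat q *v vector [a, b] = vector [a, a + inverse q * b]"
  by (rule vector_2_eqI) (simp_all add: Lmat_def matrix_vector_mult_def sum_2)

lemma Rmat_mult_vector: "Rmat q *v vector [a, b] = vector [q * a + b, b]"
  by (rule vector_2_eqI) (simp_all add: Rmat_def matrix_vector_mult_def sum_2)

theorem theorem4p3:
  fixes q :: "'a::field" and k n :: nat
  assumes "q \<noteq> 0"
    and "n \<in> {2 ^ k ..< 2 ^ (k + 1)}"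
  shows "Mmat q n *v vector [1, 1] =
    (vector [q powi (- int k) * hq q (n - 1), q powi (- int k - 1) * hq q n] :: 'a ^ 2)"
  using assms(2)
proof (induction k arbitrary: n)
  case 0
  then have "n = 1"
    by simp
  moreover have "hq q 1 = q"
    using hq_odd[of q 0] by (simp add: hq_0)
  ultimately show ?case
    using assms(1) by (simp only: Mmat_1) (simp add: hq_0 power_int_minus)
next
  case (Suc k)
  \<comment> \<open>With this shift the vector for \<open>n div 2 = m + 1\<close> has entries built
    from \<open>hq q m\<close> and \<open>hq q (m + 1)\<close>, the values occurring in the
    recurrences.\<close>
  define m where "m = n div 2 - 1"
  have half: "n div 2 \<in> {2 ^ k ..< 2 ^ (k + 1)}"
    using Suc.prems by auto
  have pos: "(1::nat) \<le> 2 ^ k"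
    by simp
  have div: "n div 2 = m + 1" and "n \<ge> 2"
    using half pos unfolding m_def by auto
  \<comment> \<open>All powers of \<open>q\<close> that occur are \<open>r\<close> times
    \<open>q\<close>, 1 or \<open>inverse q\<close>, so only field identities remain.\<close>
  define r where "r = q powi (- int (Suc k))"
  have exps: "q powi (- int k) = q * r" "q powi (- int k - 1) = r"
      "q powi (- int (Suc k) - 1) = inverse q * r"
  proof -
    have Suc_k: "- int (Suc k) = - int k - 1"
      by simp
    show "q powi (- int k) = q * r" "q powi (- int k - 1) = r"
        "q powi (- int (Suc k) - 1) = inverse q * r"
      using assms(1) unfolding r_def Suc_k by (simp_all add: power_int_diff field_simps power2_eq_square)
  qed
  have IH: "Mmat q (m + 1) *v vector [1, 1] = vector [q * r * hq q m, r * hq q (m + 1)]"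
    using Suc.IH[OF half] unfolding div exps by simp
  have step: "Mmat q n *v vector [1, 1] =
      (if even n then Lmat q else Rmat q) *v vector [q * r * hq q m, r * hq q (m + 1)]"
    by (simp only: Mmat_rec[OF \<open>n \<ge> 2\<close>] div matrix_vector_mul_assoc[symmetric] IH)
  show ?case
  proof (cases "even n")
    case True
    then have n: "n = 2 * m + 2" "n - 1 = 2 * m + 1"
      using div by presburger+
    show ?thesis
      \<comment> \<open>The term \<open>n - 1\<close> is rewritten before \<open>n\<close> itself,
        which would destroy it. The second entry then reads
        \<open>q * r * hq q m + inverse q * r * hq q (m + 1)\<close>, which is
        \<open>inverse q * r\<close> times the even recurrence.\<close>
      unfolding step exps r_def[symmetric] n(2) hq_odd
      unfolding n(1) hq_even using assms(1)
      by (simp add: Lmat_mult_vector field_simps power2_eq_square)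
  next
    case False
    then have n: "n = 2 * (m + 1) + 1" "n - 1 = 2 * m + 2"
      using div by presburger+
    show ?thesis
      \<comment> \<open>The roles are exchanged: the even recurrence gives the first entry, and in
        the second the factor \<open>q\<close> from the odd one cancels
        \<open>inverse q\<close>.\<close>
      unfolding step exps r_def[symmetric] n(2) hq_even
      unfolding n(1) hq_odd using assms(1)
      by (simp add: Rmat_mult_vector field_simps power2_eq_square)
  qed
qed

end
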